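(* Use the conventions $\binom{0}{0}=1$ and $\binom{p}{q}=0$ for integers $q>p\ge0$. Then for every positive integer $k$, the Bernoulli polynomial $B_k(u)$ equals \[ B_k(u)=(-1)^k\det\Biggl(\frac1{\ell+1}\binom{\ell+1}{m} \bigl[(1-u)^{\ell-m+1}-(-u)^{\ell-m+1}\bigr]\Biggr)_{1\le \ell\le k,\;0\le m\le k-1}, \] a $k\times k$ determinant with rows indexed by $\ell$ and columns indexed by $m$. Consequently, for every positive integer $k$, the Bernoulli number $B_k$ equals \[ B_k=(-1)^k\det\bigl(c_{\ell,m}\bigr)_{1\le \ell\le k,\;0\le m\le k-1}. \] Here $c_{\ell,m}=\frac1{\ell+1}\binom{\ell+1}{m}=\frac{1}{\ell-m+1}\binom{\ell}{m}$ for $0\le m\le \ell$, and $c_{\ell,m}=0$ for $m>\ell$.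
   Context: The Bernoulli polynomials $B_k(u)$ are defined by $\frac{ze^{uz}}{e^z-1}=\sum_{k=0}^\infty B_k(u)\frac{z^k}{k!}$ for $|z|<2\pi$. The Bernoulli numbers are $B_k=B_k(0)$. Powers with exponent $0$ are interpreted as $1$; in particular $0^0=1$. *)

theory Defs
  imports
    "HOL-Complex_Analysis.Complex_Analysis"
    "Jordan_Normal_Form.Determinant"
begin

text \<open>The singularity of the generating function at the origin is removable, with value 1.\<close>

definition bernoulli_gf :: "complex \<Rightarrow> complex \<Rightarrow> complex" where
  "bernoulli_gf u z = (if z = 0 then 1 else z * exp (u * z) / (exp z - 1))"

definition bernoulli_poly :: "nat \<Rightarrow> complex \<Rightarrow> complex" where
  "bernoulli_poly k u =
     (THE b :: nat \<Rightarrow> complex.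
        \<forall>z. norm z < 2 * pi \<longrightarrow> (\<lambda>n. b n * (z ^ n / fact n)) sums bernoulli_gf u z) k"

definition bernoulli_number :: "nat \<Rightarrow> complex" where
  "bernoulli_number k = bernoulli_poly k 0"

text \<open>
  Since the binomial coefficient in the entry vanishes for \<open>m > l + 1\<close>, the truncated
  exponent \<open>l + 1 - m\<close> only matters for \<open>m \<le> l + 1\<close>, where it is exact. For \<open>m = l + 1\<close>
  both powers have exponent 0 and the entry is 0. (Writing the exponent as \<open>l - m + 1\<close>
  would truncate to 1 there.)
\<close>

definition bernoulli_poly_entry :: "complex \<Rightarrow> nat \<Rightarrow> nat \<Rightarrow> complex" where
  "bernoulli_poly_entry u l m =
     1 / of_nat (l + 1) * of_nat ((l + 1) choose m)
       * ((1 - u) ^ (l + 1 - m) - (- u) ^ (l + 1 - m))"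

definition bernoulli_number_entry :: "nat \<Rightarrow> nat \<Rightarrow> complex" where
  "bernoulli_number_entry l m =
     (if m \<le> l then 1 / of_nat (l + 1) * of_nat ((l + 1) choose m) else 0)"

text \<open>The coefficient sequence in the definition of \<open>bernoulli_poly\<close> exists and is unique.\<close>

lemma bernoulli_gf_holomorphic: "bernoulli_gf u holomorphic_on ball 0 (2 * pi)"
proof -
  define g where "g = (\<lambda>z::complex. if z = 0 then 1 else (exp z - 1) / z)"
  have g: "g holomorphic_on UNIV"
  proof (rule pole_theorem_open_0[where a = 0 and g = "\<lambda>z. exp z - 1"])
    have "((\<lambda>z::complex. exp z - 1) has_field_derivative 1) (at 0)"
      by (auto intro!: derivative_eq_intros)
    then show "g 0 = deriv (\<lambda>z. exp z - 1) 0"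
      by (simp add: g_def DERIV_imp_deriv)
  qed (auto simp: g_def intro!: holomorphic_intros)
  have nz: "g z \<noteq> 0" if "z \<in> ball 0 (2 * pi)" for z
  proof (cases "z = 0")
    case False
    have "exp z \<noteq> 1"
    proof
      assume "exp z = 1"
      then obtain n :: int where n: "Re z = 0" "Im z = of_int (2 * n) * pi"
        by (auto simp: exp_eq_1)
      have "n \<noteq> 0" using n False by (auto simp: complex_eq_iff)
      then have "1 \<le> \<bar>real_of_int n\<bar>" by linarith
      then have "2 * pi * 1 \<le> 2 * pi * \<bar>real_of_int n\<bar>"
        by (intro mult_left_mono) auto
      also have "\<dots> = \<bar>Im z\<bar>" by (simp add: n abs_mult)
      also have "\<dots> \<le> norm z" by (rule abs_Im_le_cmod)
      finally show False using that by simp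
    qed
    with False show ?thesis by (simp add: g_def)
  qed (simp add: g_def)
  have "(\<lambda>z. exp (u * z) / g z) holomorphic_on ball 0 (2 * pi)"
    by (intro holomorphic_intros holomorphic_on_subset[OF g]) (auto simp: nz)
  moreover have "bernoulli_gf u = (\<lambda>z. exp (u * z) / g z)"
    by (auto simp: bernoulli_gf_def g_def)
  ultimately show ?thesis by simp
qed

lemma bernoulli_gf_coeffs_ex1:
  "\<exists>!b. \<forall>z. norm z < 2 * pi \<longrightarrow> (\<lambda>n. b n * (z ^ n / fact n)) sums bernoulli_gf u z"
proof (rule ex_ex1I)
  show "\<exists>b. \<forall>z. norm z < 2 * pi \<longrightarrow> (\<lambda>n. b n * (z ^ n / fact n)) sums bernoulli_gf u z"
    using holomorphic_power_series[OF bernoulli_gf_holomorphic]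
    by (intro exI[of _ "\<lambda>n. (deriv ^^ n) (bernoulli_gf u) 0"]) auto
next
  fix b c
  assume b: "\<forall>z. norm z < 2 * pi \<longrightarrow> (\<lambda>n. b n * (z ^ n / fact n)) sums bernoulli_gf u z"
  assume c: "\<forall>z. norm z < 2 * pi \<longrightarrow> (\<lambda>n. c n * (z ^ n / fact n)) sums bernoulli_gf u z"
  have ev: "eventually (\<lambda>z::complex. z \<in> ball 0 (2 * pi)) (nhds 0)"
    by (intro eventually_nhds_in_open) auto
  have *: "bernoulli_gf u has_fps_expansion Abs_fps (\<lambda>n. d n / fact n)"
    if "\<forall>z. norm z < 2 * pi \<longrightarrow> (\<lambda>n. d n * (z ^ n / fact n)) sums bernoulli_gf u z" for d
    by (rule has_fps_expansionI, rule eventually_mono[OF ev]) (use that in auto)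
  have "Abs_fps (\<lambda>n. b n / fact n) = Abs_fps (\<lambda>n. c n / fact n)"
    using fps_expansion_unique_complex *[OF b] *[OF c] by blast
  then show "b = c"
    by (auto simp: fps_eq_iff fun_eq_iff)
qed

lemma bernoulli_poly_sums:
  assumes "norm z < 2 * pi"
  shows "(\<lambda>n. bernoulli_poly n u * (z ^ n / fact n)) sums bernoulli_gf u z"
  using theI'[OF bernoulli_gf_coeffs_ex1[of u]] assms
  by (simp add: bernoulli_poly_def)

end

theory Submission
  imports Defs
begin

text \<open>
  Multiplying the generating function by \<open>exp ((1 - u) z) - exp (- u z)\<close> gives \<open>z\<close>. Comparing
  coefficients, the vector \<open>(B\<^sub>0(u), \<dots>, B\<^sub>k(u))\<close> solves a lower unitriangular linear system with
  right-hand side the first unit vector, whose matrix has the entries of the statement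
  for \<open>0 \<le> l, m \<le> k\<close>. Cramer's rule for the last unknown, expanded along the replaced column,
  leaves the minor without row \<open>0\<close> and column \<open>k\<close>.
\<close>

text \<open>Row \<open>l\<close> involves only \<open>b 0\<close>, ..., \<open>b l\<close>, so
  cutting the infinite system off at size \<open>k + 1\<close> loses nothing. The truncated matrix
  has determinant 1, so Cramer's rule needs no division and works over any commutative ring.\<close>

lemma unitriangular_solution_eq_det:
  fixes a :: "nat \<Rightarrow> nat \<Rightarrow> 'a :: comm_ring_1" and b :: "nat \<Rightarrow> 'a"
  assumes diag: "\<And>l. a l l = 1"
    and upper: "\<And>l m. l < m \<Longrightarrow> a l m = 0"
    and system: "\<And>l. (\<Sum>m\<le>l. a l m * b m) = (if l = 0 then 1 else 0)"
  shows "b k = (-1) ^ k * Determinant.det (mat k k (\<lambda>(i, m). a (i + 1) m))"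
proof -
  define T where "T = mat (Suc k) (Suc k) (\<lambda>(l, m). a l m)"
  define v where "v = vec (Suc k) b"
  define R where "R = replace_col T (T *\<^sub>v v) k"
  have T: "T \<in> carrier_mat (Suc k) (Suc k)" and v: "v \<in> carrier_vec (Suc k)"
    by (simp_all add: T_def v_def)
  have R: "R \<in> carrier_mat (Suc k) (Suc k)"
    by (simp add: R_def replace_col_def T_def)
  have det_T: "Determinant.det T = 1"
  proof -
    have "diag_mat T = replicate (Suc k) 1"
      by (rule nth_equalityI) (auto simp: diag_mat_def T_def diag simp del: upt_Suc replicate_Suc)
    with det_lower_triangular[OF _ T] show ?thesis
      by (simp add: T_def upper del: replicate_Suc)
  qed
  have Tv: "(T *\<^sub>v v) $ l = (if l = 0 then 1 else 0)" if "l \<le> k" for l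
  proof -
    have "(T *\<^sub>v v) $ l = (\<Sum>m<Suc k. a l m * b m)"
      using that by (simp add: T_def v_def scalar_prod_def atLeast0LessThan)
    also have "\<dots> = (\<Sum>m\<le>l. a l m * b m)"
      using that by (intro sum.mono_neutral_right) (auto simp: upper)
    finally show ?thesis by (simp add: system)
  qed
  have "b k = v $ k * Determinant.det T"
    by (simp add: det_T v_def)
  also have "\<dots> = Determinant.det R"
    unfolding R_def by (rule cramer_lemma_mat[OF T v, symmetric]) simp
  also have "\<dots> = (\<Sum>i<Suc k. R $$ (i, k) * cofactor R i k)"
    by (rule laplace_expansion_column[OF R]) simp
  \<comment> \<open>Column \<open>k\<close> of \<open>R\<close> is the right-hand side of the
    system, the first unit vector.\<close>
  also have "\<dots> = (\<Sum>i<Suc k. if i = 0 then cofactor R 0 k else 0)"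
    using Tv T by (intro sum.cong) (auto simp: R_def replace_col_def)
  also have "\<dots> = cofactor R 0 k"
    by simp
  \<comment> \<open>Deleting column \<open>k\<close> removes exactly the replaced column, so only
    entries of \<open>T\<close> remain; deleting row 0 causes the shift to
    \<open>i + 1\<close>.\<close>
  also have "mat_delete R 0 k = mat k k (\<lambda>(i, m). a (i + 1) m)"
    by (rule eq_matI) (auto simp: mat_delete_def R_def replace_col_def T_def)
  then have "cofactor R 0 k = (-1) ^ k * Determinant.det (mat k k (\<lambda>(i, m). a (i + 1) m))"
    by (simp add: cofactor_def)
  finally show ?thesis .
qed

lemma bernoulli_gf_has_fps_expansion:
  "bernoulli_gf u has_fps_expansion Abs_fps (\<lambda>n. bernoulli_poly n u / fact n)"
proof (rule has_fps_expansionI)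
  have "eventually (\<lambda>z::complex. z \<in> ball 0 (2 * pi)) (nhds 0)"
    by (intro eventually_nhds_in_open) auto
  then show "eventually (\<lambda>z. (\<lambda>n. fps_nth (Abs_fps (\<lambda>n. bernoulli_poly n u / fact n)) n * z ^ n)
      sums bernoulli_gf u z) (nhds 0)"
    by eventually_elim (use bernoulli_poly_sums in auto)
qed

text \<open>The radius \<open>pi\<close> is that of a disc around 0 on which \<open>exp\<close> is
  injective, so \<open>exp z - 1\<close> vanishes there only at 0. A neighbourhood of 0 suffices for
  comparing coefficients.\<close>

lemma bernoulli_gf_mult_exp_diff:
  assumes "norm z < pi"
  shows "bernoulli_gf u z * (exp ((1 - u) * z) - exp (- u * z)) = z"
proof (cases "z = 0")
  case False
  have "exp z \<noteq> exp 0"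
    using inj_onD[OF inj_on_exp_pi[of 0], of z 0] assms False by auto
  then have "exp z - 1 \<noteq> 0" by simp
  moreover have "exp ((1 - u) * z) - exp (- u * z) = (exp z - 1) * exp (- (u * z))"
    by (simp add: algebra_simps flip: exp_add)
  ultimately show ?thesis
    using False by (simp add: bernoulli_gf_def exp_minus)
qed simp

text \<open>Both series are expansions at 0 of functions that agree near 0, and such expansions are
  unique.\<close>

lemma bernoulli_poly_fps:
  "Abs_fps (\<lambda>n. bernoulli_poly n u / fact n) * (fps_exp (1 - u) - fps_exp (- u)) = fps_X"
    (is "?F = _")
proof (rule fps_expansion_unique_complex)
  let ?f = "\<lambda>z. bernoulli_gf u z * (exp ((1 - u) * z) - exp (- u * z))"
  show "?f has_fps_expansion ?F"
    by (intro fps_expansion_intros bernoulli_gf_has_fps_expansion)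
  have "eventually (\<lambda>z::complex. z \<in> ball 0 pi) (nhds 0)"
    by (intro eventually_nhds_in_open) auto
  then have "eventually (\<lambda>z. ?f z = z) (nhds 0)"
    by eventually_elim (use bernoulli_gf_mult_exp_diff in auto)
  then show "?f has_fps_expansion fps_X"
    by (subst has_fps_expansion_cong[OF _ refl]) (auto intro: fps_expansion_intros)
qed

text \<open>This is \<open>fact l\<close> times the coefficient of degree \<open>l + 1\<close> in
  \<open>bernoulli_poly_fps\<close>: the factor \<open>1 / (l + 1)\<close> in the entry turns
  \<open>fact (l + 1)\<close> from the binomial into \<open>fact l\<close>.\<close>

lemma sum_bernoulli_poly_entry:
  "(\<Sum>m\<le>l. bernoulli_poly_entry u l m * bernoulli_poly m u) = (if l = 0 then 1 else 0)"
proof -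
  let ?w = "\<lambda>n. (1 - u) ^ n - (- u) ^ n"
  have "(\<Sum>m\<le>l. bernoulli_poly_entry u l m * bernoulli_poly m u)
      = (\<Sum>m\<le>l. fact l * (bernoulli_poly m u / fact m * (?w (Suc l - m) / fact (Suc l - m))))"
  proof (rule sum.cong)
    fix m assume "m \<in> {..l}"
    then have "of_nat (Suc l choose m) = (fact (Suc l) / (fact m * fact (Suc l - m)) :: complex)"
      by (intro binomial_fact) auto
    then show "bernoulli_poly_entry u l m * bernoulli_poly m u
        = fact l * (bernoulli_poly m u / fact m * (?w (Suc l - m) / fact (Suc l - m)))"
      by (simp add: bernoulli_poly_entry_def fact_Suc del: of_nat_Suc binomial_Suc_Suc)
  qed simp
  \<comment> \<open>The added term \<open>m = Suc l\<close> is zero because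
    \<open>?w 0 = 1 - 1\<close>; it completes the Cauchy product.\<close>
  also have "\<dots> = fact l * (\<Sum>m=0..Suc l. bernoulli_poly m u / fact m * (?w (Suc l - m) / fact (Suc l - m)))"
    by (simp add: sum_distrib_left atMost_atLeast0)
  also have "\<dots> = fact l * fps_nth (Abs_fps (\<lambda>n. bernoulli_poly n u / fact n)
      * (fps_exp (1 - u) - fps_exp (- u))) (Suc l)"
    by (simp only: fps_mult_nth fps_sub_nth fps_exp_nth fps_nth_Abs_fps of_nat_fact
          diff_divide_distrib)
  also have "\<dots> = (if l = 0 then 1 else 0)"
    by (simp add: bernoulli_poly_fps)
  finally show ?thesis .
qed

lemma bernoulli_poly_eq_det:
  "bernoulli_poly k u
     = (-1) ^ k * Determinant.det (mat k k (\<lambda>(i, m). bernoulli_poly_entry u (i + 1) m))"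
proof (rule unitriangular_solution_eq_det)
  \<comment> \<open>On the diagonal the binomial is \<open>l + 1\<close> and the bracket is
    \<open>(1 - u) - (- u) = 1\<close>.\<close>
  show "bernoulli_poly_entry u l l = 1" for l
    by (simp add: bernoulli_poly_entry_def del: of_nat_Suc)
  show "bernoulli_poly_entry u l m = 0" if "l < m" for l m
    using that by (cases "m = l + 1") (simp_all add: bernoulli_poly_entry_def)
qed (rule sum_bernoulli_poly_entry)

text \<open>For \<open>m \<le> l\<close> the exponent is positive, so the power of 0 vanishes; for
  \<open>m = l + 1\<close> it is \<open>0 ^ 0 = 1\<close> and cancels the other power; beyond that
  the binomial is 0.\<close>

lemma bernoulli_poly_entry_0: "bernoulli_poly_entry 0 l m = bernoulli_number_entry l m"
  by (cases "m = l + 1") (auto simp: bernoulli_poly_entry_def bernoulli_number_entry_def)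

lemma inverse_Suc_times_binomial:
  assumes "m \<le> l"
  shows "(1 / of_nat (l + 1) * of_nat ((l + 1) choose m) :: 'a :: field_char_0)
    = 1 / of_nat (l - m + 1) * of_nat (l choose m)"
proof -
  have "(l - m + 1) * ((l + 1) choose m) = (l + 1) * (l choose m)"
    using binomial_absorb_comp[of "l + 1" m] assms by (simp add: Suc_diff_le)
  then have "of_nat (l - m + 1) * of_nat ((l + 1) choose m) = (of_nat (l + 1) * of_nat (l choose m) :: 'a)"
    by (metis of_nat_mult)
  moreover have "of_nat (l - m + 1) \<noteq> (0 :: 'a)" "of_nat (l + 1) \<noteq> (0 :: 'a)"
    unfolding of_nat_eq_0_iff by simp_all
  ultimately show ?thesis
    by (simp add: field_simps del: of_nat_Suc of_nat_add)
qed

theorem theorem1p2: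
  shows "(\<forall>k\<ge>1. \<forall>u :: complex.
            bernoulli_poly k u
              = (-1) ^ k * Determinant.det (mat k k (\<lambda>(i, m). bernoulli_poly_entry u (i + 1) m)))
       \<and> (\<forall>k\<ge>1.
            bernoulli_number k
              = (-1) ^ k * Determinant.det (mat k k (\<lambda>(i, m). bernoulli_number_entry (i + 1) m)))
       \<and> (\<forall>l m :: nat. m \<le> l \<longrightarrow>
            (1 / of_nat (l + 1) * of_nat ((l + 1) choose m) :: complex)
              = 1 / of_nat (l - m + 1) * of_nat (l choose m))"
  using bernoulli_poly_eq_det[of _ 0]
  by (auto simp only: bernoulli_number_def bernoulli_poly_entry_0 bernoulli_poly_eq_det
        inverse_Suc_times_binomial)

end
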